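(* Let $\mathscr{A}$ be a $C^*$-algebra, $\mathscr{H}$ a Hilbert $\mathscr{A}$-module, and let $A\in\mathcal{L}(\mathscr{H})$ satisfy the generalized Cauchy--Schwarz inequality, i.e. $A\in GCSI(\mathscr{H})$. Then $\mathcal{N}(A)=\mathcal{N}(A^2)$.
   Context: $\mathcal{L}(\mathscr{H})$ is the $C^*$-algebra of adjointable operators on the Hilbert $C^*$-module $(\mathscr{H},\langle\cdot,\cdot\rangle)$, with norm $\|x\|=\|\langle x,x\rangle\|^{1/2}$ on $\mathscr{H}$. $\mathcal{N}(A)$ denotes the null space of $A$. An operator $A\in\mathcal{L}(\mathscr{H})$ is said to satisfy the generalized Cauchy--Schwarz inequality if there exists $\lambda\in(0,1)$ such that $\|\langle Ax,y\rangle\|\le(\|Ax\|\,\|y\|)^{\lambda}(\|Ay\|\,\|x\|)^{1-\lambda}$ for all $x,y\in\mathscr{H}$; the collection of all such adjointable operators is denoted $GCSI(\mathscr{H})$. *)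

theory Defs
  imports Complex_Main
begin

class complex_vector = real_vector +
  fixes scaleC :: "complex \<Rightarrow> 'a \<Rightarrow> 'a"  (infixr \<open>*\<^sub>C\<close> 75)
  assumes scaleC_add_right: "c *\<^sub>C (x + y) = c *\<^sub>C x + c *\<^sub>C y"
    and scaleC_add_left: "(c + d) *\<^sub>C x = c *\<^sub>C x + d *\<^sub>C x"
    and scaleC_scaleC: "c *\<^sub>C d *\<^sub>C x = (c * d) *\<^sub>C x"
    and scaleC_one: "1 *\<^sub>C x = x"
    and scaleR_scaleC: "r *\<^sub>R x = complex_of_real r *\<^sub>C x"

class complex_banach = complex_vector + banach +
  assumes norm_scaleC: "norm (c *\<^sub>C x) = cmod c * norm x"

text \<open>No unit is required; the zero algebra is allowed.\<close>

class cstar_algebra = complex_banach + real_normed_algebra +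
  fixes star :: "'a \<Rightarrow> 'a"
  assumes mult_scaleC_left: "(c *\<^sub>C a) * b = c *\<^sub>C (a * b)"
    and mult_scaleC_right: "a * (c *\<^sub>C b) = c *\<^sub>C (a * b)"
    and star_add: "star (a + b) = star a + star b"
    and star_scaleC: "star (c *\<^sub>C a) = cnj c *\<^sub>C star a"
    and star_mult: "star (a * b) = star b * star a"
    and star_star: "star (star a) = a"
    and cstar_identity: "norm (star a * a) = (norm a)\<^sup>2"

text \<open>In any C*-algebra, unital or not, the positive elements are those of the form \<open>b\<^sup>* b\<close>.\<close>

definition cstar_pos :: "'a::cstar_algebra \<Rightarrow> bool" where
  "cstar_pos a \<longleftrightarrow> (\<exists>b. a = star b * b)"

text \<open>
  Right modules, with inner product conjugate-linear in the first argument and linear in the second.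
  The module is complete because its type is in class \<^class>\<open>banach\<close> and \<open>norm_eq_sqrt_ip\<close>
  identifies the norm of that class with the one induced by the inner product.
  Conjugate linearity in the first argument follows from \<open>ip_star\<close>.
\<close>

locale hilbert_cstar_module =
  fixes ip :: "'h::complex_banach \<Rightarrow> 'h \<Rightarrow> 'a::cstar_algebra"
    and act :: "'h \<Rightarrow> 'a \<Rightarrow> 'h"  (infixl \<open>\<cdot>\<close> 75)
  assumes act_add_left: "(x + y) \<cdot> a = x \<cdot> a + y \<cdot> a"
    and act_add_right: "x \<cdot> (a + b) = x \<cdot> a + x \<cdot> b"
    and act_act: "x \<cdot> a \<cdot> b = x \<cdot> (a * b)"
    and act_scaleC_left: "(c *\<^sub>C x) \<cdot> a = c *\<^sub>C (x \<cdot> a)"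
    and act_scaleC_right: "x \<cdot> (c *\<^sub>C a) = c *\<^sub>C (x \<cdot> a)"
    and ip_add_right: "ip x (y + z) = ip x y + ip x z"
    and ip_scaleC_right: "ip x (c *\<^sub>C y) = c *\<^sub>C ip x y"
    and ip_act_right: "ip x (y \<cdot> a) = ip x y * a"
    and ip_star: "ip y x = star (ip x y)"
    and ip_pos: "cstar_pos (ip x x)"
    and ip_definite: "ip x x = 0 \<Longrightarrow> x = 0"
    and norm_eq_sqrt_ip: "norm x = sqrt (norm (ip x x))"

text \<open>
  The algebra \<open>\<L>(\<H>)\<close>. Linearity and boundedness of an adjointable map are consequences of the
  existence of an adjoint.
\<close>

definition adjointable :: "('h \<Rightarrow> 'h \<Rightarrow> 'a) \<Rightarrow> ('h \<Rightarrow> 'h) set" where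
  "adjointable ip = {A. \<exists>B. \<forall>x y. ip (A x) y = ip x (B y)}"

definition GCSI :: "('h::complex_banach \<Rightarrow> 'h \<Rightarrow> 'a::cstar_algebra) \<Rightarrow> ('h \<Rightarrow> 'h) set" where
  "GCSI ip = {A \<in> adjointable ip. \<exists>l. 0 < l \<and> l < 1 \<and> (\<forall>x y.
     norm (ip (A x) y) \<le> (norm (A x) * norm y) powr l * (norm (A y) * norm x) powr (1 - l))}"

definition nullspace :: "('h::zero \<Rightarrow> 'h) \<Rightarrow> 'h set" where
  "nullspace A = {x. A x = 0}"

end

theory Submission
  imports Defs
begin

text \<open>
  Taking \<open>y = A x\<close> in the generalized Cauchy--Schwarz inequality bounds
  \<open>\<parallel>\<langle>A x, A x\<rangle>\<parallel> = \<parallel>A x\<parallel>\<^sup>2\<close> by a product whose second factor is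
  \<open>(\<parallel>A (A x)\<parallel> \<parallel>x\<parallel>)\<close> to the power \<open>1 - \<lambda>\<close>. That factor vanishes as soon as \<open>A (A x) = 0\<close>,
  so \<open>A x = 0\<close>. It also vanishes for \<open>x = 0\<close>, so the inequality itself gives \<open>A 0 = 0\<close>, which is
  what the inclusion of the null space of \<open>A\<close> in that of its square requires.
\<close>

lemma GCSI_eq_0:
  assumes "hilbert_cstar_module ip act" and "A \<in> GCSI ip"
    and "A (A x) = 0 \<or> x = 0"
  shows "A x = 0"
proof -
  interpret hilbert_cstar_module ip act by fact
  obtain l where
    "norm (ip (A x) (A x)) \<le>
       (norm (A x) * norm (A x)) powr l * (norm (A (A x)) * norm x) powr (1 - l)"
    using assms(2) unfolding GCSI_def by blast
  with assms(3) have "ip (A x) (A x) = 0" by auto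
  then show ?thesis by (rule ip_definite)
qed

theorem theorem2p10:
  fixes ip :: "'h::complex_banach \<Rightarrow> 'h \<Rightarrow> 'a::cstar_algebra"
    and act :: "'h \<Rightarrow> 'a \<Rightarrow> 'h"
    and A :: "'h \<Rightarrow> 'h"
  assumes "hilbert_cstar_module ip act"
    and "A \<in> GCSI ip"
  shows "nullspace A = nullspace (A \<circ> A)"
proof -
  have "A 0 = 0" by (rule GCSI_eq_0[OF assms]) blast
  moreover have "A x = 0" if "A (A x) = 0" for x
    by (rule GCSI_eq_0[OF assms]) (use that in blast)
  ultimately have "A x = 0 \<longleftrightarrow> A (A x) = 0" for x by metis
  then show ?thesis by (simp only: nullspace_def comp_apply)
qed

end
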